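(* Let $X$ be an LPPE and let $\mathcal{A}$ be its PA. Let $i$ be a summand of $X$ such that for all $\boldsymbol{g}\in\boldsymbol{G}$ and $\boldsymbol{d_i}\in\boldsymbol{D_i}$ we have $a_i(\boldsymbol{g},\boldsymbol{d_i})=\tau$ and there exists $\boldsymbol{e_i}\in\boldsymbol{E_i}$ with $f_i(\boldsymbol{g},\boldsymbol{d_i},\boldsymbol{e_i})=1$. Write $\boldsymbol{n_i}(\boldsymbol{g},\boldsymbol{d_i})$ for the unique target state $\boldsymbol{n_i}(\boldsymbol{g},\boldsymbol{d_i},\boldsymbol{e_i})$ with $f_i(\boldsymbol{g},\boldsymbol{d_i},\boldsymbol{e_i})=1$. Suppose that for every summand $j$ of $X$ (including $j=i$) and all $\boldsymbol{g}\in\boldsymbol{G}$, $\boldsymbol{d_i}\in\boldsymbol{D_i}$, $\boldsymbol{d_j}\in\boldsymbol{D_j}$, $\boldsymbol{e_j}\in\boldsymbol{E_j}$ (where for $j=i$ the values $\boldsymbol{d_i}$ and $\boldsymbol{d_j}$ are quantified independently): if $c_i(\boldsymbol{g},\boldsymbol{d_i})\wedge c_j(\boldsymbol{g},\boldsymbol{d_j})$, then either $i=j$ and $\boldsymbol{n_i}(\boldsymbol{g},\boldsymbol{d_i})=\boldsymbol{n_j}(\boldsymbol{g},\boldsymbol{d_j})$, or all of the following hold: (1) $c_j(\boldsymbol{n_i}(\boldsymbol{g},\boldsymbol{d_i}),\boldsymbol{d_j})$ and $c_i(\boldsymbol{n_j}(\boldsymbol{g},\boldsymbol{d_j},\boldsymbol{e_j}),\boldsymbol{d_i})$;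 (2) $a_j(\boldsymbol{g},\boldsymbol{d_j})=a_j(\boldsymbol{n_i}(\boldsymbol{g},\boldsymbol{d_i}),\boldsymbol{d_j})$; (3) $f_j(\boldsymbol{g},\boldsymbol{d_j},\boldsymbol{e_j})=f_j(\boldsymbol{n_i}(\boldsymbol{g},\boldsymbol{d_i}),\boldsymbol{d_j},\boldsymbol{e_j})$; (4) $\boldsymbol{n_j}(\boldsymbol{n_i}(\boldsymbol{g},\boldsymbol{d_i}),\boldsymbol{d_j},\boldsymbol{e_j})=\boldsymbol{n_i}(\boldsymbol{n_j}(\boldsymbol{g},\boldsymbol{d_j},\boldsymbol{e_j}),\boldsymbol{d_i})$. Then the set of transitions of $\mathcal{A}$ generated by summand $i$ is probabilistically confluent.
   Context: Distributions and PAs. $\mathrm{Distr}(S)$ is the set of probability distributions on a countable set $S$; $\mathbb{1}_t$ is the deterministic distribution with $\mathbb{1}_t(t)=1$. For an equivalence relation $R$ on $S$, $\mu\equiv_R\mu'$ means $\mu(C)=\mu'(C)$ for all $C\in S/R$, where $\mu(C)=\sum_{s\in C}\mu(s)$. A probabilistic automaton (PA) is a tuple $\langle S,s^0,L,\Delta\rangle$ with $S$ a countable set of states, $s^0\in S$ initial, $L$ a countable set of actions containing the unobservable action $\tau$, and $\Delta\subseteq S\times L\times\mathrm{Distr}(S)$ a countable transition relation. Write $s\xrightarrow{a}\mu$ for $(s,a,\mu)\in\Delta$. LPPEs. A linear probabilistic process equation (LPPE) $X$ has a vector of global variables $\boldsymbol{g}$ of type $\boldsymbol{G}$ (and an initial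 value) and a finite collection of summands. Summand $i$ has the form $$\sum_{\boldsymbol{d_i}:\boldsymbol{D_i}}c_i(\boldsymbol{g},\boldsymbol{d_i})\Rightarrow a_i(\boldsymbol{g},\boldsymbol{d_i})\ \sum_{\boldsymbol{e_i}:\boldsymbol{E_i}}^{\bullet} f_i(\boldsymbol{g},\boldsymbol{d_i},\boldsymbol{e_i}):X(\boldsymbol{n_i}(\boldsymbol{g},\boldsymbol{d_i},\boldsymbol{e_i})),$$ where $\boldsymbol{D_i}$ and $\boldsymbol{E_i}$ are (countable) types of local and probabilistic variables, $c_i$ is a Boolean condition, $a_i$ gives an action, $f_i(\boldsymbol{g},\boldsymbol{d_i},\cdot)$ is a probability distribution on $\boldsymbol{E_i}$, and $\boldsymbol{n_i}(\boldsymbol{g},\boldsymbol{d_i},\boldsymbol{e_i})\in\boldsymbol{G}$ is the next state. Informally: $\boldsymbol{d_i}$ with $c_i(\boldsymbol{g},\boldsymbol{d_i})$ is chosen nondeterministically, action $a_i(\boldsymbol{g},\boldsymbol{d_i})$ is taken, and $\boldsymbol{e_i}$ is chosen with probability $f_i(\boldsymbol{g},\boldsymbol{d_i},\boldsymbol{e_i})$. Semantics. The PA of $X$ has as states all vectors $\boldsymbol{g}\in\boldsymbol{G}$. Summand $i$ generates the transition $\boldsymbol{g}\xrightarrow{a}\mu$ if there is $\boldsymbol{d_i}\in\boldsymbol{D_i}$ such that $c_i(\boldsymbol{g},\boldsymbol{d_i})$ holds, $a_i(\boldsymbol{g},\boldsymbol{d_i})=a$, and for all $\boldsymbol{e_i}\in\boldsymbol{E_i}$,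 $\mu(\boldsymbol{n_i}(\boldsymbol{g},\boldsymbol{d_i},\boldsymbol{e_i}))=\sum f_i(\boldsymbol{g},\boldsymbol{d_i},\boldsymbol{e_i'})$, the sum ranging over all $\boldsymbol{e_i'}\in\boldsymbol{E_i}$ with $\boldsymbol{n_i}(\boldsymbol{g},\boldsymbol{d_i},\boldsymbol{e_i})=\boldsymbol{n_i}(\boldsymbol{g},\boldsymbol{d_i},\boldsymbol{e_i'})$. The transitions of the PA are exactly those generated by at least one summand. Confluence. Let $c$ be a set of $\tau$-transitions with deterministic distributions. Write $s\to_c t$ if $(s,\tau,\mathbb{1}_t)\in c$; $s\twoheadrightarrow_c t$ if there is a finite (possibly empty) path of $\to_c$-steps from $s$ to $t$. Let $R_c=\{(s,s')\mid\exists u:\ s\twoheadrightarrow_c u\text{ and }s'\twoheadrightarrow_c u\}$. The set $c$ is probabilistically confluent if $R_c$ is an equivalence relation and, for every path $s\twoheadrightarrow_c t$ and all $a\in L$, $\mu\in\mathrm{Distr}(S)$: $s\xrightarrow{a}\mu$ implies [($\exists\nu\in\mathrm{Distr}(S)$: $t\xrightarrow{a}\nu$ and $\mu\equiv_{R_c}\nu$) or ($a=\tau$ and $\mu\equiv_{R_c}\mathbb{1}_{t}$)]. *)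

theory Defs
  imports "HOL-Probability.Probability_Mass_Function"
begin

section \<open>Distributions\<close>

text \<open>Discrete distributions are elements of \<open>pmf\<close>; those living on the state set \<open>S\<close> are the ones
  whose support is contained in \<open>S\<close>. The mass \<open>\<mu>(C)\<close> of a set is \<open>measure_pmf.prob \<mu> C\<close>.\<close>

definition Distr :: "'s set \<Rightarrow> 's pmf set" where
  "Distr S = {\<mu>. set_pmf \<mu> \<subseteq> S}"

lemma prob_eq_infsum_pmf:
  "measure_pmf.prob \<mu> C = (\<Sum>\<^sub>\<infinity>s\<in>C. pmf \<mu> s)"
  by (simp add: measure_pmf_conv_infsetsum infsetsum_infsum pmf_abs_summable)

definition dist_equiv :: "'s set \<Rightarrow> ('s \<times> 's) set \<Rightarrow> 's pmf \<Rightarrow> 's pmf \<Rightarrow> bool" where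
  "dist_equiv S R \<mu> \<mu>' \<longleftrightarrow>
    (\<forall>C\<in>S // R. measure_pmf.prob \<mu> C = measure_pmf.prob \<mu>' C)"


section \<open>Probabilistic automata\<close>

datatype 'a action = Tau | Obs 'a

type_synonym ('s, 'a) transition = "'s \<times> 'a action \<times> 's pmf"

record ('s, 'a) pa =
  states :: "'s set"
  init :: 's
  actions :: "'a action set"
  trans_rel :: "('s, 'a) transition set"

definition is_pa :: "('s, 'a) pa \<Rightarrow> bool" where
  "is_pa A \<longleftrightarrow>
    countable (states A) \<and>
    init A \<in> states A \<and>
    countable (actions A) \<and>
    Tau \<in> actions A \<and>
    countable (trans_rel A) \<and>
    trans_rel A \<subseteq> states A \<times> actions A \<times> Distr (states A)"


section \<open>Probabilistic confluence\<close>

definition det_step :: "('s, 'a) transition set \<Rightarrow> ('s \<times> 's) set" where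
  "det_step c = {(s, t). (s, Tau, return_pmf t) \<in> c}"

definition joinable :: "'s set \<Rightarrow> ('s, 'a) transition set \<Rightarrow> ('s \<times> 's) set" where
  "joinable S c =
    {(s, s'). s \<in> S \<and> s' \<in> S \<and> (\<exists>u. (s, u) \<in> (det_step c)\<^sup>* \<and> (s', u) \<in> (det_step c)\<^sup>*)}"

text \<open>The first two conjuncts express that \<open>c\<close> is a set of invisible transitions of the automaton,
  all of which have a deterministic distribution.\<close>

definition prob_confluent :: "('s, 'a) pa \<Rightarrow> ('s, 'a) transition set \<Rightarrow> bool" where
  "prob_confluent A c \<longleftrightarrow>
    c \<subseteq> trans_rel A \<and>
    (\<forall>(s, a, \<mu>)\<in>c. a = Tau \<and> (\<exists>t\<in>states A. \<mu> = return_pmf t)) \<and>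
    equiv (states A) (joinable (states A) c) \<and>
    (\<forall>s\<in>states A. \<forall>t\<in>states A. (s, t) \<in> (det_step c)\<^sup>* \<longrightarrow>
      (\<forall>a\<in>actions A. \<forall>\<mu>\<in>Distr (states A). (s, a, \<mu>) \<in> trans_rel A \<longrightarrow>
        (\<exists>\<nu>\<in>Distr (states A). (t, a, \<nu>) \<in> trans_rel A \<and>
           dist_equiv (states A) (joinable (states A) c) \<mu> \<nu>) \<or>
        (a = Tau \<and> dist_equiv (states A) (joinable (states A) c) \<mu> (return_pmf t))))"


section \<open>Linear probabilistic process equations\<close>

text \<open>Each summand has its own types of local and probabilistic variables. They are represented by
  carrier sets inside common ambient types \<open>'d\<close> and \<open>'e\<close>, which are unrestricted type variables, and
  likewise \<open>G\<close> is a carrier set inside \<open>'g\<close>. Only the values of the component functions on these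
  carriers matter. \<open>f\<^sub>i(g, d, e)\<close> is \<open>pmf (dist_fun s g d) e\<close>.\<close>

record ('g, 'd, 'e, 'a) summand =
  local_dom :: "'d set"
  prob_dom :: "'e set"
  cond :: "'g \<Rightarrow> 'd \<Rightarrow> bool"
  act_fun :: "'g \<Rightarrow> 'd \<Rightarrow> 'a action"
  dist_fun :: "'g \<Rightarrow> 'd \<Rightarrow> 'e pmf"
  next_fun :: "'g \<Rightarrow> 'd \<Rightarrow> 'e \<Rightarrow> 'g"

record ('g, 'd, 'e, 'a) lppe =
  global_dom :: "'g set"
  init_global :: 'g
  alphabet :: "'a action set"
  summands :: "('g, 'd, 'e, 'a) summand list"

definition is_summand ::
  "'g set \<Rightarrow> 'a action set \<Rightarrow> ('g, 'd, 'e, 'a) summand \<Rightarrow> bool" where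
  "is_summand G L s \<longleftrightarrow>
    countable (local_dom s) \<and>
    countable (prob_dom s) \<and>
    (\<forall>g\<in>G. \<forall>d\<in>local_dom s.
       act_fun s g d \<in> L \<and>
       dist_fun s g d \<in> Distr (prob_dom s) \<and>
       (\<forall>e\<in>prob_dom s. next_fun s g d e \<in> G))"

definition is_lppe :: "('g, 'd, 'e, 'a) lppe \<Rightarrow> bool" where
  "is_lppe X \<longleftrightarrow>
    countable (global_dom X) \<and>
    init_global X \<in> global_dom X \<and>
    countable (alphabet X) \<and>
    Tau \<in> alphabet X \<and>
    (\<forall>s\<in>set (summands X). is_summand (global_dom X) (alphabet X) s)"

definition summand_trans ::
  "'g set \<Rightarrow> ('g, 'd, 'e, 'a) summand \<Rightarrow> ('g, 'a) transition set" where
  "summand_trans G s =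
    {(g, a, \<mu>). g \<in> G \<and> \<mu> \<in> Distr G \<and>
       (\<exists>d\<in>local_dom s. cond s g d \<and> act_fun s g d = a \<and>
          (\<forall>e\<in>prob_dom s. pmf \<mu> (next_fun s g d e) =
             (\<Sum>\<^sub>\<infinity>e'\<in>{e'\<in>prob_dom s. next_fun s g d e = next_fun s g d e'}. pmf (dist_fun s g d) e')))}"

definition lppe_pa :: "('g, 'd, 'e, 'a) lppe \<Rightarrow> ('g, 'a) pa" where
  "lppe_pa X =
    \<lparr>states = global_dom X,
     init = init_global X,
     actions = alphabet X,
     trans_rel = (\<Union>s\<in>set (summands X). summand_trans (global_dom X) s)\<rparr>"

text \<open>The target state \<open>n\<^sub>i(g, d)\<close>; meaningful when some \<open>e\<close> has probability one.\<close>

definition det_next :: "('g, 'd, 'e, 'a) summand \<Rightarrow> 'g \<Rightarrow> 'd \<Rightarrow> 'g" where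
  "det_next s g d =
    (THE t. \<exists>e\<in>prob_dom s. pmf (dist_fun s g d) e = 1 \<and> t = next_fun s g d e)"


section \<open>Well-formedness of the semantics\<close>

lemma summand_trans_eq:
  assumes "is_summand G L s"
  shows "summand_trans G s =
    (\<lambda>(g, d). (g, act_fun s g d, map_pmf (next_fun s g d) (dist_fun s g d))) `
      {(g, d). g \<in> G \<and> d \<in> local_dom s \<and> cond s g d}" (is "_ = ?R")
proof -
  have prob: "(\<Sum>\<^sub>\<infinity>e'\<in>{e'\<in>prob_dom s. next_fun s g d e = next_fun s g d e'}. pmf (dist_fun s g d) e')
      = pmf (map_pmf (next_fun s g d) (dist_fun s g d)) (next_fun s g d e)"
    if "g \<in> G" "d \<in> local_dom s" for g d e
  proof -
    have sub: "set_pmf (dist_fun s g d) \<subseteq> prob_dom s"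
      using assms that by (auto simp: is_summand_def Distr_def)
    have "pmf (map_pmf (next_fun s g d) (dist_fun s g d)) (next_fun s g d e) =
        measure_pmf.prob (dist_fun s g d) (next_fun s g d -` {next_fun s g d e})"
      by (simp add: pmf_map)
    also have "\<dots> = measure_pmf.prob (dist_fun s g d)
        {e'\<in>prob_dom s. next_fun s g d e = next_fun s g d e'}"
      using sub by (intro measure_pmf.finite_measure_eq_AE) (auto simp: AE_measure_pmf_iff)
    finally show ?thesis
      by (simp add: prob_eq_infsum_pmf)
  qed
  have uniq: "\<mu> = map_pmf (next_fun s g d) (dist_fun s g d)"
    if gd: "g \<in> G" "d \<in> local_dom s"
      and eq: "\<forall>e\<in>prob_dom s. pmf \<mu> (next_fun s g d e) =
        pmf (map_pmf (next_fun s g d) (dist_fun s g d)) (next_fun s g d e)" for g d \<mu>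
  proof -
    let ?\<nu> = "map_pmf (next_fun s g d) (dist_fun s g d)"
    let ?N = "next_fun s g d ` prob_dom s"
    have sub: "set_pmf ?\<nu> \<subseteq> ?N"
      using assms gd by (auto simp: is_summand_def Distr_def)
    have "measure_pmf.prob \<mu> ?N = measure_pmf.prob ?\<nu> ?N"
      unfolding prob_eq_infsum_pmf using eq by (intro infsum_cong) auto
    also have "\<dots> = 1"
      using sub by (auto simp: measure_pmf.prob_eq_1 AE_measure_pmf_iff)
    finally have "set_pmf \<mu> \<subseteq> ?N"
      by (auto simp: measure_pmf.prob_eq_1 AE_measure_pmf_iff)
    show ?thesis
    proof (rule pmf_eqI)
      fix t show "pmf \<mu> t = pmf ?\<nu> t"
      proof (cases "t \<in> ?N")
        case True then show ?thesis using eq by auto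
      next
        case False
        then have "t \<notin> set_pmf \<mu>" "t \<notin> set_pmf ?\<nu>"
          using sub \<open>set_pmf \<mu> \<subseteq> ?N\<close> by auto
        then show ?thesis by (simp only: pmf_eq_0_set_pmf[symmetric])
      qed
    qed
  qed
  have mem: "map_pmf (next_fun s g d) (dist_fun s g d) \<in> Distr G"
    if "g \<in> G" "d \<in> local_dom s" for g d
    using assms that by (auto simp: is_summand_def Distr_def)
  show ?thesis
    unfolding summand_trans_def
    by (auto simp: prob image_iff dest: uniq intro: mem) (use uniq in blast)
qed

lemma is_pa_lppe_pa:
  assumes "is_lppe X"
  shows "is_pa (lppe_pa X)"
proof -
  have sm: "is_summand (global_dom X) (alphabet X) s" if "s \<in> set (summands X)" for s
    using assms that by (simp add: is_lppe_def)
  have "countable (summand_trans (global_dom X) s)" if "s \<in> set (summands X)" for s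
  proof -
    have "countable (global_dom X \<times> local_dom s)"
      using assms sm[OF that] by (auto simp: is_lppe_def is_summand_def)
    then have "countable {(g, d). g \<in> global_dom X \<and> d \<in> local_dom s \<and> cond s g d}"
      by (rule countable_subset[rotated]) auto
    then show ?thesis
      unfolding summand_trans_eq[OF sm[OF that]] by (rule countable_image)
  qed
  moreover have "summand_trans (global_dom X) s \<subseteq>
      global_dom X \<times> alphabet X \<times> Distr (global_dom X)" if "s \<in> set (summands X)" for s
    using sm[OF that] by (auto simp: summand_trans_def is_summand_def)
  ultimately show ?thesis
    using assms by (auto simp: is_pa_def lppe_pa_def is_lppe_def countable_finite intro!: countable_UN)
qed

end

theory Submission
  imports Defs "HOL-Library.Confluence"
begin

text \<open>The hypotheses make every step of summand \<open>i\<close> commute with every transition, up to one further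
  step of summand \<open>i\<close>. Taking \<open>j = i\<close> gives the diamond property, hence joinability is transitive.
  For a single step from \<open>g\<close> to \<open>t\<close> and a transition of summand \<open>j\<close> from \<open>g\<close>, the same summand with
  the same local variables is enabled in \<open>t\<close> and has the same distribution over \<open>E\<^sub>j\<close>; for each
  outcome the two target states are one step of summand \<open>i\<close> apart, so all equivalence
  classes receive the same mass. Paths follow by induction.\<close>

lemma dist_equiv_refl: "dist_equiv S R \<mu> \<mu>"
  by (simp add: dist_equiv_def)

lemma dist_equiv_trans:
  "dist_equiv S R \<mu> \<nu> \<Longrightarrow> dist_equiv S R \<nu> \<rho> \<Longrightarrow> dist_equiv S R \<mu> \<rho>"
  by (simp add: dist_equiv_def)

text \<open>Both sides are images of the same \<open>D\<close>, so \<open>f\<close> and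
  \<open>g\<close> couple them outcome by outcome. A class of \<open>R\<close> contains
  \<open>f e\<close> iff it contains \<open>g e\<close>, hence its two preimages differ only by a
  null set of \<open>D\<close>.\<close>

lemma dist_equiv_map_pmf:
  assumes R: "equiv S R" and rel: "\<And>e. e \<in> set_pmf D \<Longrightarrow> (f e, g e) \<in> R"
  shows "dist_equiv S R (map_pmf f D) (map_pmf g D)"
  unfolding dist_equiv_def
proof
  fix C assume "C \<in> S // R"
  then obtain x where C: "C = R `` {x}"
    by (rule quotientE)
  have "sym R" "trans R"
    using R by (auto elim: equivE)
  then have "f e \<in> C \<longleftrightarrow> g e \<in> C" if "e \<in> set_pmf D" for e
    unfolding C Image_singleton_iff using rel[OF that] by (meson symD transD)
  then show "measure_pmf.prob (map_pmf f D) C = measure_pmf.prob (map_pmf g D) C"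
    unfolding measure_map_pmf
    by (intro measure_pmf.finite_measure_eq_AE) (simp_all add: AE_measure_pmf_iff)
qed

lemma dist_equiv_return_pmf:
  assumes "equiv S R" "(x, y) \<in> R"
  shows "dist_equiv S R (return_pmf x) (return_pmf y)"
  using dist_equiv_map_pmf[OF assms(1), of "return_pmf ()" "\<lambda>_. x" "\<lambda>_. y"] assms(2) by simp

text \<open>Strong confluence yields confluence, which is what transitivity rests on: if x and y
  meet in u, and y and z meet in v, then u and v are both reachable from y and so reach a common w,
  where x and z meet.\<close>

lemma equiv_joinable:
  assumes "strong_confluentp (\<lambda>x y. (x, y) \<in> det_step c)"
  shows "equiv S (joinable S c)"
proof (rule equivI)
  let ?J = "\<lambda>x y. \<exists>u. (x, u) \<in> (det_step c)\<^sup>* \<and> (y, u) \<in> (det_step c)\<^sup>*"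
  have mem: "(x, y) \<in> joinable S c \<longleftrightarrow> x \<in> S \<and> y \<in> S \<and> ?J x y" for x y
    unfolding joinable_def by simp
  show "joinable S c \<subseteq> S \<times> S"
    unfolding joinable_def by (rule subsetI) (simp add: split_beta mem_Times_iff)
  show "refl_on S (joinable S c)"
    by (rule refl_onI) (use mem in blast)
  show "sym (joinable S c)"
    by (rule symI) (metis mem)
  show "trans (joinable S c)"
  proof (rule transI)
    fix x y z assume xy: "(x, y) \<in> joinable S c" and yz: "(y, z) \<in> joinable S c"
    obtain u where u: "(x, u) \<in> (det_step c)\<^sup>*" "(y, u) \<in> (det_step c)\<^sup>*"
      using xy unfolding mem by (elim conjE exE)
    obtain v where v: "(y, v) \<in> (det_step c)\<^sup>*" "(z, v) \<in> (det_step c)\<^sup>*"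
      using yz unfolding mem by (elim conjE exE)
    obtain w where w: "(u, w) \<in> (det_step c)\<^sup>*" "(v, w) \<in> (det_step c)\<^sup>*"
      using confluentpD[OF strong_confluentp_imp_confluentp[OF assms], unfolded Transitive_Closure.rtranclp_rtrancl_eq,
          OF u(2) v(1)] by (elim exE conjE)
    have "?J x z"
      using rtrancl_trans[OF u(1) w(1)] rtrancl_trans[OF v(2) w(2)] by (intro exI conjI)
    then show "(x, z) \<in> joinable S c"
      using xy yz unfolding mem by simp
  qed
qed

lemma pmf_eq_1_iff: "pmf p x = 1 \<longleftrightarrow> p = return_pmf x"
proof
  assume "pmf p x = 1"
  then have "AE y in measure_pmf p. y \<in> {x}"
    using measure_pmf.prob_eq_1[of "{x}" p] by (simp add: measure_pmf_single)
  then have "set_pmf p \<subseteq> {x}" by (auto simp: AE_measure_pmf_iff)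
  then show "p = return_pmf x" by (simp add: set_pmf_subset_singleton)
qed simp

text \<open>An outcome of mass 1 makes the distribution a point mass, so there is only one such
  outcome and the definite description in \<open>det_next\<close> is justified.\<close>

lemma det_next_eq:
  assumes "e \<in> prob_dom s" "pmf (dist_fun s g d) e = 1"
  shows "det_next s g d = next_fun s g d e"
  unfolding det_next_def
proof (rule the_equality)
  fix t assume "\<exists>e\<in>prob_dom s. pmf (dist_fun s g d) e = 1 \<and> t = next_fun s g d e"
  then show "t = next_fun s g d e"
    using assms(2) by (metis pmf_eq_1_iff return_pmf_inj)
qed (use assms in blast)

lemma map_pmf_next_fun_det:
  assumes "e \<in> prob_dom s" "pmf (dist_fun s g d) e = 1"
  shows "map_pmf (next_fun s g d) (dist_fun s g d) = return_pmf (det_next s g d)"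
  using assms(2) det_next_eq[OF assms] by (simp add: pmf_eq_1_iff)

text \<open>Trades the pointwise mass condition for an image distribution, the form that
  \<open>dist_equiv_map_pmf\<close> can compare.\<close>

lemma mem_summand_trans_iff:
  assumes "is_summand G L s"
  shows "(g, a, \<mu>) \<in> summand_trans G s \<longleftrightarrow>
    g \<in> G \<and> (\<exists>d\<in>local_dom s. cond s g d \<and> a = act_fun s g d \<and>
      \<mu> = map_pmf (next_fun s g d) (dist_fun s g d))"
  unfolding summand_trans_eq[OF assms] by (auto simp: image_iff)

text \<open>Condition (3) compares masses only on the carrier of the probabilistic variables;
  outside it both masses vanish.\<close>

lemma pmf_eqI_Distr:
  assumes "p \<in> Distr E" "q \<in> Distr E" "\<And>e. e \<in> E \<Longrightarrow> pmf p e = pmf q e"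
  shows "p = q"
proof (rule pmf_eqI)
  fix e show "pmf p e = pmf q e"
  proof (cases "e \<in> E")
    case False
    then have "e \<notin> set_pmf p" "e \<notin> set_pmf q"
      using assms(1,2) unfolding Distr_def by blast+
    then show ?thesis by (simp only: pmf_eq_0_set_pmf[symmetric])
  qed (rule assms(3))
qed

theorem theorem28:
  fixes X :: "('g, 'd, 'e, 'a) lppe"
    and G :: "'g set"
    and s :: "nat \<Rightarrow> ('g, 'd, 'e, 'a) summand"
    and i :: nat
  defines "G \<equiv> global_dom X"
    and "s \<equiv> \<lambda>j. summands X ! j"
  assumes lppe: "is_lppe X"
    and i: "i < length (summands X)"
    and det_tau: "\<forall>g\<in>G. \<forall>d\<in>local_dom (s i).
      act_fun (s i) g d = Tau \<and> (\<exists>e\<in>prob_dom (s i). pmf (dist_fun (s i) g d) e = 1)"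
    and commute: "\<forall>j<length (summands X). \<forall>g\<in>G.
      \<forall>di\<in>local_dom (s i). \<forall>dj\<in>local_dom (s j). \<forall>ej\<in>prob_dom (s j).
      cond (s i) g di \<and> cond (s j) g dj \<longrightarrow>
        (i = j \<and> det_next (s i) g di = det_next (s j) g dj) \<or>
        (cond (s j) (det_next (s i) g di) dj \<and>
         cond (s i) (next_fun (s j) g dj ej) di \<and>
         act_fun (s j) g dj = act_fun (s j) (det_next (s i) g di) dj \<and>
         pmf (dist_fun (s j) g dj) ej = pmf (dist_fun (s j) (det_next (s i) g di) dj) ej \<and>
         next_fun (s j) (det_next (s i) g di) dj ej = det_next (s i) (next_fun (s j) g dj ej) di)"
  shows "prob_confluent (lppe_pa X) (summand_trans G (s i))"
proof -
  let ?c = "summand_trans G (s i)"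
  let ?r = "det_step ?c"
  let ?R = "joinable G ?c"
  have sm: "is_summand G (alphabet X) (s j)" if "j < length (summands X)" for j
    using lppe that by (simp add: is_lppe_def G_def s_def)
  have det: "map_pmf (next_fun (s i) g d) (dist_fun (s i) g d) = return_pmf (det_next (s i) g d)"
      "det_next (s i) g d \<in> G" "act_fun (s i) g d = Tau"
    if gd: "g \<in> G" "d \<in> local_dom (s i)" for g d
  proof -
    obtain e where e: "e \<in> prob_dom (s i)" "pmf (dist_fun (s i) g d) e = 1"
      using det_tau gd by blast
    show "map_pmf (next_fun (s i) g d) (dist_fun (s i) g d) = return_pmf (det_next (s i) g d)"
      using e by (rule map_pmf_next_fun_det)
    show "det_next (s i) g d \<in> G"
      using det_next_eq[OF e] sm[OF i] gd e(1) by (simp add: is_summand_def)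
    show "act_fun (s i) g d = Tau"
      using det_tau gd by blast
  qed
  have c_iff: "(g, a, \<mu>) \<in> ?c \<longleftrightarrow> g \<in> G \<and> a = Tau \<and>
      (\<exists>d\<in>local_dom (s i). cond (s i) g d \<and> \<mu> = return_pmf (det_next (s i) g d))" for g a \<mu>
    unfolding mem_summand_trans_iff[OF sm[OF i]] using det(1,3) by metis
  have step_iff: "(g, t) \<in> ?r \<longleftrightarrow>
      g \<in> G \<and> (\<exists>d\<in>local_dom (s i). cond (s i) g d \<and> t = det_next (s i) g d)" for g t
    by (simp add: det_step_def c_iff)
  have stepE: "\<exists>d\<in>local_dom (s i). g \<in> G \<and> cond (s i) g d \<and> t = det_next (s i) g d"
    if "(g, t) \<in> ?r" for g t
    using that unfolding step_iff by blast
  have stepI: "(g, det_next (s i) g d) \<in> ?r"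
    if "g \<in> G" "d \<in> local_dom (s i)" "cond (s i) g d" for g d
    unfolding step_iff using that by blast
  have path_in_G: "t \<in> G" if "(g, t) \<in> ?r\<^sup>*" "g \<in> G" for g t
    using that
  proof (induction rule: rtrancl_induct)
    case (step y z)
    obtain d where "d \<in> local_dom (s i)" "z = det_next (s i) y d" "y \<in> G"
      using stepE[OF step.hyps(2)] by blast
    then show ?case using det(2) by blast
  qed
  have equiv: "equiv G ?R"
  proof (rule equiv_joinable, rule strong_confluentpI, unfold Transitive_Closure.rtranclp_rtrancl_eq)
    fix x y z assume "(x, y) \<in> ?r" "(x, z) \<in> ?r"
    then obtain d d' where x: "x \<in> G"
      and d: "d \<in> local_dom (s i)" "cond (s i) x d" "y = det_next (s i) x d"
      and d': "d' \<in> local_dom (s i)" "cond (s i) x d'" "z = det_next (s i) x d'"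
      using stepE[of x y] stepE[of x z] by blast
    \<comment> \<open>\<open>commute\<close> speaks of \<open>next_fun\<close> at a chosen outcome;
      taking the outcome of mass 1 makes that target equal to \<open>z\<close>.\<close>
    obtain e where e: "e \<in> prob_dom (s i)" "pmf (dist_fun (s i) x d') e = 1"
      using det_tau x d'(1) by blast
    have z: "z = next_fun (s i) x d' e"
      using d'(3) det_next_eq[OF e] by simp
    show "\<exists>u. (y, u) \<in> ?r\<^sup>* \<and> (\<lambda>x y. (x, y) \<in> ?r)\<^sup>=\<^sup>= z u"
    proof (cases "y = z")
      case True
      then show ?thesis by (intro exI[of _ z]) simp
    next
      case False
      \<comment> \<open>With \<open>j = i\<close>, the first alternative of \<open>commute\<close>
        would give \<open>y = z\<close>. By (3) the outcome \<open>e\<close> still has mass 1 at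
        \<open>y\<close>, so (4) becomes an equation between two \<open>det_next\<close> states,
        which closes the diamond.\<close>
      then have *: "cond (s i) y d'" "cond (s i) z d" "pmf (dist_fun (s i) y d') e = 1"
          "next_fun (s i) y d' e = det_next (s i) z d"
        using commute[rule_format, OF i x d(1) d'(1) e(1)] d d' e(2) z by auto
      have "det_next (s i) y d' = det_next (s i) z d"
        using det_next_eq[OF e(1) *(3)] *(4) by simp
      moreover have "y \<in> G" "z \<in> G"
        using d d' x det(2) by auto
      ultimately show ?thesis
        using stepI[OF _ d'(1) *(1)] stepI[OF _ d(1) *(2)]
        by (intro exI[of _ "det_next (s i) z d"]) simp
    qed
  qed
  have joinableI: "(x, y) \<in> ?R" if "(x, y) \<in> ?r\<^sup>*" "x \<in> G" for x y
    using that path_in_G by (auto simp: joinable_def)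
  have trans_eq: "trans_rel (lppe_pa X) = (\<Union>j<length (summands X). summand_trans G (s j))"
    unfolding lppe_pa_def G_def s_def by (force simp: in_set_conv_nth)

  have sim_step: "(\<exists>\<nu>\<in>Distr G. (t, a, \<nu>) \<in> trans_rel (lppe_pa X) \<and> dist_equiv G ?R \<mu> \<nu>) \<or>
      (a = Tau \<and> dist_equiv G ?R \<mu> (return_pmf t))"
    if st: "(g, t) \<in> ?r" and tr: "(g, a, \<mu>) \<in> trans_rel (lppe_pa X)" for g t a \<mu>
  proof -
    obtain di where g: "g \<in> G"
      and di: "di \<in> local_dom (s i)" "cond (s i) g di" "t = det_next (s i) g di"
      using stepE[OF st] by blast
    have t: "t \<in> G" using di g det(2) by simp
    obtain j where j: "j < length (summands X)" "(g, a, \<mu>) \<in> summand_trans G (s j)"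
      using tr unfolding trans_eq by blast
    obtain dj where dj: "dj \<in> local_dom (s j)" "cond (s j) g dj" "a = act_fun (s j) g dj"
      and \<mu>: "\<mu> = map_pmf (next_fun (s j) g dj) (dist_fun (s j) g dj)"
      using j(2) unfolding mem_summand_trans_iff[OF sm[OF j(1)]] by blast
    show ?thesis
    proof (cases "i = j \<and> det_next (s i) g di = det_next (s j) g dj")
      \<comment> \<open>Here the given transition is the step to \<open>t\<close> itself:
        \<open>a\<close> is \<open>Tau\<close> and \<open>\<mu>\<close> is the point mass at
        \<open>t\<close>, so \<open>t\<close> matches it by staying put.\<close>
      case True
      then show ?thesis
        using det[OF g] dj di(3) \<mu> by (auto simp: dist_equiv_refl)
    next
      case False
      then have comm: "cond (s j) t dj" "cond (s i) (next_fun (s j) g dj e) di"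
          "a = act_fun (s j) t dj"
          "pmf (dist_fun (s j) g dj) e = pmf (dist_fun (s j) t dj) e"
          "next_fun (s j) t dj e = det_next (s i) (next_fun (s j) g dj e) di"
        if "e \<in> prob_dom (s j)" for e
        using commute[rule_format, OF j(1) g di(1) dj(1) that] di(2,3) dj(2,3) by auto
      have Distr: "dist_fun (s j) g dj \<in> Distr (prob_dom (s j))"
          "dist_fun (s j) t dj \<in> Distr (prob_dom (s j))"
        using sm[OF j(1)] g t dj(1) by (auto simp: is_summand_def)
      have same: "dist_fun (s j) g dj = dist_fun (s j) t dj"
        using Distr comm(4) by (rule pmf_eqI_Distr)
      \<comment> \<open>The condition and the action at \<open>t\<close> do not involve an outcome,
        but \<open>comm\<close> is available only for a given one; a distribution has nonempty
        support.\<close>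
      obtain e where e: "e \<in> prob_dom (s j)"
        using Distr(1) set_pmf_not_empty[of "dist_fun (s j) g dj"] unfolding Distr_def by blast
      let ?\<nu> = "map_pmf (next_fun (s j) t dj) (dist_fun (s j) t dj)"
      have "(t, a, ?\<nu>) \<in> summand_trans G (s j)"
        unfolding mem_summand_trans_iff[OF sm[OF j(1)]] using t dj(1) comm(1,3)[OF e] by blast
      moreover from this have "?\<nu> \<in> Distr G"
        by (simp add: summand_trans_def)
      \<comment> \<open>After rewriting with \<open>same\<close>, both are images of one
        distribution. For each outcome, (4) says that the step with \<open>di\<close> leads from the
        target reached from \<open>g\<close> to the target reached from \<open>t\<close>.\<close>
      moreover have "dist_equiv G ?R \<mu> ?\<nu>"
        unfolding \<mu> same
      proof (rule dist_equiv_map_pmf[OF equiv])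
        fix e assume "e \<in> set_pmf (dist_fun (s j) t dj)"
        then have e: "e \<in> prob_dom (s j)" using Distr(2) by (auto simp: Distr_def)
        then have "next_fun (s j) g dj e \<in> G"
          using sm[OF j(1)] g dj(1) by (auto simp: is_summand_def)
        then show "(next_fun (s j) g dj e, next_fun (s j) t dj e) \<in> ?R"
          using stepI[OF _ di(1) comm(2)[OF e]] comm(5)[OF e] by (auto intro: joinableI)
      qed
      ultimately show ?thesis
        using j(1) unfolding trans_eq by blast
    qed
  qed

  \<comment> \<open>The path is extended at its end, with \<open>g\<close> and \<open>\<mu>\<close>
    fixed: a matching transition found at \<open>t\<close> is itself carried over to the next state
    by \<open>sim_step\<close>.\<close>
  have sim: "(\<exists>\<nu>\<in>Distr G. (t, a, \<nu>) \<in> trans_rel (lppe_pa X) \<and> dist_equiv G ?R \<mu> \<nu>) \<or>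
      (a = Tau \<and> dist_equiv G ?R \<mu> (return_pmf t))"
    if "(g, t) \<in> ?r\<^sup>*" "g \<in> G" "\<mu> \<in> Distr G" "(g, a, \<mu>) \<in> trans_rel (lppe_pa X)" for g t a \<mu>
    using that(1)
  proof (induction rule: rtrancl_induct)
    case base
    then show ?case using that dist_equiv_refl by blast
  next
    case (step t t')
    from step.IH show ?case
    proof (elim disjE bexE conjE)
      fix \<nu> assume "(t, a, \<nu>) \<in> trans_rel (lppe_pa X)" "dist_equiv G ?R \<mu> \<nu>"
      then show ?thesis
        using sim_step[OF step.hyps(2)] dist_equiv_trans by meson
    next
      \<comment> \<open>Once matched by staying put, the action remains so: \<open>t\<close> and
        \<open>t'\<close> are joinable, hence their point masses are equivalent.\<close>
      assume "a = Tau" "dist_equiv G ?R \<mu> (return_pmf t)"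
      moreover have "(t, t') \<in> ?R"
        using joinableI[OF r_into_rtrancl[OF step.hyps(2)]] path_in_G[OF step.hyps(1) that(2)] .
      ultimately show ?thesis
        using dist_equiv_return_pmf[OF equiv] dist_equiv_trans by blast
    qed
  qed

  have "states (lppe_pa X) = G"
    by (simp add: lppe_pa_def G_def)
  moreover have "?c \<subseteq> trans_rel (lppe_pa X)"
    unfolding trans_eq using i by blast
  moreover have "\<forall>(g, a, \<mu>)\<in>?c. a = Tau \<and> (\<exists>t\<in>G. \<mu> = return_pmf t)"
  proof (rule ballI, unfold split_beta)
    fix tr assume tr: "tr \<in> ?c"
    obtain g a \<mu> where "tr = (g, a, \<mu>)" by (rule prod_cases3)
    with tr show "fst (snd tr) = Tau \<and> (\<exists>t\<in>G. snd (snd tr) = return_pmf t)"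
      using c_iff[of g a \<mu>] det(2)[of g] by auto
  qed
  ultimately show ?thesis
    unfolding prob_confluent_def using equiv sim by simp
qed

end
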